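(* Fix $i,j\in\{1,\dots,k\}$. Let $J_i,J_j:[0,1]\to[0,\infty)$ be weights-generating functions, $H_r=h_r\circ F^{-1}$ and $g_r=J_rH_r'$ for $r\in\{i,j\}$. Then the following three expressions for $\sigma_{ij}^2$ are equal: $$\int_0^1\alpha_i(u)\,\alpha_j(u)\,du,$$ $$\int_0^1\left(\frac{1}{1-u}\right)^2\left[\int_u^1(1-v)\,g_i(v)\,dv\int_u^1(1-w)\,g_j(w)\,dw\right]du,$$ $$\int_0^1\int_0^1 g_i(v)\,g_j(w)\,K(v,w)\,dv\,dw.$$ Moreover, if for $r\in\{i,j\}$ the weights-generating function is the trimming one, $$J_r(s)=\begin{cases}(1-a_r-b_r)^{-1}, & a_r<s<1-b_r,\\ 0, &\text{otherwise},\end{cases}$$ where $0\le a_r<1-b_r\le 1$, then these expressions are also equal to $$\Gamma\int_{a_i}^{1-b_i}\int_{a_j}^{1-b_j}K(v,w)\,H_j'(v)\,H_i'(w)\,dv\,dw,\qquad \Gamma=\frac{1}{(1-a_i-b_i)(1-a_j-b_j)}.$$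
   Context: $F$ is a cumulative distribution function on the real line, with quantile function $F^{-1}(u)=\inf\{x:F(x)\ge u\}$. The $h_r$ are given real functions, and $H_r:=h_r\circ F^{-1}$. $H_r'$ is the derivative of $H_r$, in the sense $H_r'(u)\,du=dh_r(F^{-1}(u))$. For $r\in\{i,j\}$ and $0\le u<1$, $$\alpha_r(u)=\frac{1}{1-u}\int_u^1(1-v)\,g_r(v)\,dv,\qquad g_r(v)=J_r(v)H_r'(v).$$ The kernel is $K(v,w)=\min\{v,w\}-vw$ for $0\le v,w\le1$. Standing integrability assumptions: $g_i,g_j$ are Lebesgue measurable on $[0,1]$; for each $u\in(0,1)$ the functions $v\mapsto(1-v)g_r(v)$ ($r\in\{i,j\}$) are Lebesgue integrable on $[u,1]$; and the function $(1-u)^{-2}(1-v)(1-w)g_i(v)g_j(w)$ is absolutely integrable on $\Omega=\{(u,v,w)\in[0,1]^3: u\le v,\ u\le w\}$, so that Fubini's theorem applies. *)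

theory Defs
  imports "HOL-Probability.Probability"
begin

text \<open>
  The quantile function is meaningful for \<open>0 < u < 1\<close> only: the set below is unbounded from below for
  \<open>u \<le> 0\<close> and may be empty for \<open>u \<ge> 1\<close>, where \<open>Inf\<close> on the reals has an arbitrary value.
\<close>
definition quantile :: "(real \<Rightarrow> real) \<Rightarrow> real \<Rightarrow> real" where
  "quantile F u = Inf {x. F x \<ge> u}"

text \<open>
  \<open>H' du = dH\<close> on the open interval \<open>(0,1)\<close>, as an identity of Stieltjes differentials: on every compact
  subinterval \<open>H'\<close> is Lebesgue integrable and integrates to the increment of \<open>H\<close>. It determines
  \<open>H'\<close> up to null sets and does not ask for pointwise differentiability. The endpoints are excluded
  because \<open>quantile F\<close> may be infinite there.
\<close>
definition stieltjes_derivative :: "(real \<Rightarrow> real) \<Rightarrow> (real \<Rightarrow> real) \<Rightarrow> bool" where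
  "stieltjes_derivative H H' \<longleftrightarrow>
     (\<forall>a b. 0 < a \<and> a \<le> b \<and> b < 1 \<longrightarrow>
        H' absolutely_integrable_on {a..b} \<and>
        (LINT u:{a..b}|lebesgue. H' u) = H b - H a)"

definition alpha :: "(real \<Rightarrow> real) \<Rightarrow> real \<Rightarrow> real" where
  "alpha g u = 1 / (1 - u) * (LINT v:{u..1}|lebesgue. (1 - v) * g v)"

definition bridge_kernel :: "real \<Rightarrow> real \<Rightarrow> real" where
  "bridge_kernel v w = min v w - v * w"

definition Omega :: "(real \<times> real \<times> real) set" where
  "Omega = {(u, v, w). u \<in> {0..1} \<and> v \<in> {0..1} \<and> w \<in> {0..1} \<and> u \<le> v \<and> u \<le> w}"

definition trimming_weight :: "real \<Rightarrow> real \<Rightarrow> real \<Rightarrow> real" where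
  "trimming_weight a b s = (if a < s \<and> s < 1 - b then inverse (1 - a - b) else 0)"

text \<open>
  Existence of \<open>\<integral>\<^bsub>B\<^esub> \<integral>\<^bsub>A\<^esub> f v w dv dw\<close> as an iterated Lebesgue integral (the inner one for almost every
  \<open>w\<close>). The library's integral is 0 for functions that are not integrable, so existence has to be
  stated separately from the value.
\<close>
definition iterated_integrable :: "real set \<Rightarrow> real set \<Rightarrow> (real \<Rightarrow> real \<Rightarrow> real) \<Rightarrow> bool" where
  "iterated_integrable A B f \<longleftrightarrow>
     (AE w in lebesgue_on B. (\<lambda>v. f v w) absolutely_integrable_on A) \<and>
     (\<lambda>w. LINT v:A|lebesgue. f v w) absolutely_integrable_on B"

end

theory Submission
  imports Defs
begin

text \<open>
  After replacing \<open>g\<^sub>i\<close> and \<open>g\<^sub>j\<close> by Borel functions that agree with them almost everywhere, the theorem is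
  Fubini for \<open>(1 - u)\<^sup>-\<^sup>2 (1 - v) (1 - w) g\<^sub>i(v) g\<^sub>j(w)\<close> on \<open>Omega\<close>. Integrating over \<open>(v, w)\<close> first, the
  integrand factors and gives the product of the tail integrals. Integrating over \<open>u\<close> first, with
  \<open>m = min v w\<close>, one gets
  \<open>(1 - v) (1 - w) \<integral>\<^sub>0\<^sup>m (1 - u)\<^sup>-\<^sup>2 du = (1 - v) (1 - w) m / (1 - m) = m (1 - max v w) = min v w - v w\<close>.
  The trimming weights only restrict the domain and rescale, up to the endpoints, which are null;
  the roles of \<open>i\<close> and \<open>j\<close> are then exchanged by the symmetry of the kernel and Fubini again.
\<close>

section \<open>Passing between Lebesgue integrals and Borel representatives\<close>

lemma AE_borel_measurable_completion:
  fixes f g :: "'a \<Rightarrow> real"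
  assumes g: "g \<in> borel_measurable M" and eq: "AE x in M. f x = g x"
  shows "f \<in> borel_measurable (completion M)"
proof (rule measurableI)
  fix A :: "real set" assume A: "A \<in> sets borel"
  have "g \<in> borel_measurable (completion M)" using g by (rule measurable_completion)
  then have "g -` A \<inter> space M \<in> sets (completion M)"
    using A by (metis measurable_sets space_completion)
  \<comment> \<open>The two preimages differ only inside a null set, and every subset of a null set
    is measurable in the completion.\<close>
  moreover have "AE x in completion M. x \<in> g -` A \<inter> space M \<longleftrightarrow> x \<in> f -` A \<inter> space M"
    by (rule AE_completion) (use eq in eventually_elim, auto)
  ultimately show "f -` A \<inter> space (completion M) \<in> sets (completion M)"
    using completion.in_sets_AE[where A = "g -` A \<inter> space M" and B = "f -` A \<inter> space M"] by simp
qed auto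

lemma integral_completion_AE:
  fixes f g :: "'a \<Rightarrow> real"
  assumes g: "g \<in> borel_measurable M" and eq: "AE x in M. f x = g x"
  shows "integrable (completion M) f \<longleftrightarrow> integrable M g" (is ?int)
    and "integral\<^sup>L (completion M) f = integral\<^sup>L M g" (is ?eq)
proof -
  note meas = AE_borel_measurable_completion[OF g eq] measurable_completion[OF g]
  have "integrable (completion M) f \<longleftrightarrow> integrable (completion M) g"
    by (rule integrable_cong_AE[OF meas AE_completion[OF eq]])
  then show ?int by (simp add: integrable_completion[OF g])
  show ?eq
    using integral_cong_AE[OF meas AE_completion[OF eq]] by (simp add: integral_completion[OF g])
qed

text \<open>Bridge from integrals over a set with respect to \<open>lebesgue\<close> to
  \<open>lborel\<close>, whose product measure carries Fubini. \<open>g\<close> represents the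
  extension of \<open>f\<close> by zero off \<open>A\<close>, so it absorbs the indicator as
  well.\<close>

lemma set_integral_lebesgue_AE:
  fixes f g :: "'a::euclidean_space \<Rightarrow> real"
  assumes g: "g \<in> borel_measurable borel"
    and eq: "AE x in lborel. indicator A x *\<^sub>R f x = g x"
  shows "f absolutely_integrable_on A \<longleftrightarrow> integrable lborel g"
    and "(LINT x:A|lebesgue. f x) = integral\<^sup>L lborel g"
  using integral_completion_AE[of g lborel, OF _ eq] g
  by (simp_all add: set_integrable_def set_lebesgue_integral_def)

text \<open>The nested almost-everywhere hypothesis suits a slicewise argument: for almost every
  \<open>w\<close> the one-variable transfer applies to the inner integral, then once more to the
  outer one. Integrability of \<open>G\<close> on the product supplies the integrable
  slices.\<close>

lemma iterated_integral_AE: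
  fixes f G :: "real \<Rightarrow> real \<Rightarrow> real"
  assumes G: "integrable (lborel \<Otimes>\<^sub>M lborel) (\<lambda>(v, w). G v w)"
    and [measurable]: "A \<in> sets borel" "B \<in> sets borel"
    and eq: "AE w in lborel. AE v in lborel. indicator B w * indicator A v * f v w = G v w"
  shows "iterated_integrable A B f"
    and "(LINT w:B|lebesgue. LINT v:A|lebesgue. f v w) = integral\<^sup>L (lborel \<Otimes>\<^sub>M lborel) (\<lambda>(v, w). G v w)"
proof -
  have meas[measurable]: "(\<lambda>(v, w). G v w) \<in> borel_measurable (borel \<Otimes>\<^sub>M borel)"
    using borel_measurable_integrable[OF G] by (simp add: measurable_cong_sets[OF sets_pair_measure_cong[OF sets_lborel sets_lborel] refl])
  have "AE w in lborel. w \<in> B \<longrightarrow> (\<lambda>v. f v w) absolutely_integrable_on A"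
    using eq lborel_pair.AE_integrable_snd[OF G]
  proof eventually_elim
    case (elim w)
    then show ?case
      using set_integral_lebesgue_AE(1)[of "\<lambda>v. G v w" A "\<lambda>v. f v w"] by auto
  qed
  then have inner: "AE w in lebesgue_on B. (\<lambda>v. f v w) absolutely_integrable_on A"
    by (subst AE_restrict_space_iff) (auto intro: AE_completion)
  have "AE w in lborel. indicator B w *\<^sub>R (LINT v:A|lebesgue. f v w) = (\<integral>v. G v w \<partial>lborel)"
    using eq
  proof eventually_elim
    case (elim w)
    show ?case
    proof (cases "w \<in> B")
      case True
      with elim show ?thesis
        using set_integral_lebesgue_AE(2)[of "\<lambda>v. G v w" A "\<lambda>v. f v w"] by auto
    next
      case False
      \<comment> \<open>Off \<open>B\<close> the left side of \<open>eq\<close> is 0, so this slice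
        of \<open>G\<close> vanishes almost everywhere.\<close>
      with elim have "(\<integral>v. G v w \<partial>lborel) = 0"
        by (intro integral_eq_zero_AE) auto
      with False show ?thesis by simp
    qed
  qed
  note outer = set_integral_lebesgue_AE[OF _ this]
  show "iterated_integrable A B f"
    unfolding iterated_integrable_def
    using inner outer(1) lborel_pair.integrable_snd[OF G] by auto
  show "(LINT w:B|lebesgue. LINT v:A|lebesgue. f v w) = integral\<^sup>L (lborel \<Otimes>\<^sub>M lborel) (\<lambda>(v, w). G v w)"
    using outer(2) lborel_pair.integral_snd[OF G] by auto
qed

section \<open>Null sets of one coordinate in a product\<close>

lemma AE_lborel_fst:
  fixes P :: "'a::euclidean_space \<Rightarrow> bool"
  assumes "AE x in lborel. P x"
  shows "AE z in (lborel :: ('a \<times> 'b::euclidean_space) measure). P (fst z)"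
proof -
  \<comment> \<open>\<open>P\<close> may be non-measurable, so its exceptional set is first enclosed
    in a Borel null set; the cylinder over that set is null by Fubini.\<close>
  obtain N where N: "N \<in> null_sets lborel" "{x. \<not> P x} \<subseteq> N"
    using assms unfolding eventually_ae_filter by (auto simp: space_lborel)
  have [measurable]: "N \<in> sets borel"
    using null_setsD2[OF N(1)] by simp
  have "AE z in lborel \<Otimes>\<^sub>M (lborel :: 'b measure). fst z \<notin> N"
  proof (rule lborel_pair.AE_pair_measure)
    show "AE x in lborel. AE y in lborel. fst (x, y) \<notin> N"
      using AE_not_in[OF N(1)] by eventually_elim simp
  qed measurable
  then show ?thesis
    unfolding lborel_prod by (rule eventually_mono) (use N(2) in blast)
qed

lemma AE_lborel_snd:
  fixes P :: "'b::euclidean_space \<Rightarrow> bool"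
  assumes "AE y in lborel. P y"
  shows "AE z in (lborel :: ('a::euclidean_space \<times> 'b) measure). P (snd z)"
proof -
  obtain N where N: "N \<in> null_sets lborel" "{x. \<not> P x} \<subseteq> N"
    using assms unfolding eventually_ae_filter by (auto simp: space_lborel)
  have [measurable]: "N \<in> sets borel"
    using null_setsD2[OF N(1)] by simp
  have "AE z in (lborel :: 'a measure) \<Otimes>\<^sub>M lborel. snd z \<notin> N"
  proof (rule lborel_pair.AE_pair_measure)
    show "AE x in lborel. AE y in lborel. snd (x, y) \<notin> N"
      using AE_not_in[OF N(1)] by simp
  qed measurable
  then show ?thesis
    unfolding lborel_prod by (rule eventually_mono) (use N(2) in blast)
qed

section \<open>The two orders of integration over \<open>Omega\<close>\<close>

lemma integral_inverse_square:
  fixes m :: real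
  assumes "0 \<le> m" "m < 1"
  shows "(\<integral>u. indicator {0..m} u * (1 / (1 - u)\<^sup>2) \<partial>lborel) = m / (1 - m)"
proof -
  have "(\<integral>u. indicator {0..m} u *\<^sub>R (1 / (1 - u)\<^sup>2) \<partial>lborel) = 1 / (1 - m) - 1 / (1 - 0)"
    by (rule integral_FTC_Icc)
       (use assms in \<open>auto intro!: derivative_eq_intros continuous_intros
          simp: power2_eq_square simp flip: has_real_derivative_iff_has_vector_derivative\<close>)
  also have "\<dots> = m / (1 - m)" using assms by (simp add: field_simps)
  finally show ?thesis by simp
qed

lemma bridge_kernel_commute: "bridge_kernel v w = bridge_kernel w v"
  by (simp add: bridge_kernel_def min.commute)

text \<open>Turns an indicator with moving endpoint \<open>u\<close> into comparisons, from which
  joint measurability in \<open>u\<close> and \<open>v\<close> follows; this gives the measurability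
  of the tail integrals as functions of \<open>u\<close>.\<close>

lemma indicator_Icc_left: "indicator {u..c} v * x = (if u \<le> v \<and> v \<le> c then x else (0::real))"
  for u v c :: real
  by (simp add: indicator_def)

context
  fixes p q :: "real \<Rightarrow> real" and \<Phi> :: "real \<Rightarrow> real \<times> real \<Rightarrow> real"
  assumes p[measurable]: "p \<in> borel_measurable borel" and q[measurable]: "q \<in> borel_measurable borel"
  defines "\<Phi> \<equiv> \<lambda>u (v, w). indicator Omega (u, v, w) * (1 / (1 - u)\<^sup>2 * (1 - v) * (1 - w) * p v * q w)"
begin

text \<open>Once \<open>u\<close> is fixed, the constraints of \<open>Omega\<close> on
  \<open>v\<close> and \<open>w\<close> decouple, so each slice is a product of one-variable
  functions.\<close>

lemma Phi_product:
  "\<Phi> u (v, w) = indicator {0..1} u * (1 / (1 - u))\<^sup>2 *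
     (indicator {u..1} v * ((1 - v) * p v)) * (indicator {u..1} w * ((1 - w) * q w))"
  by (auto simp: \<Phi>_def Omega_def indicator_def power_divide)

lemma Phi_kernel:
  "(\<integral>u. \<Phi> u (v, w) \<partial>lborel) =
     indicator {0..1} w * indicator {0..1} v * (p v * q w * bridge_kernel v w)"
proof (cases "0 \<le> v \<and> v \<le> 1 \<and> 0 \<le> w \<and> w \<le> 1")
  case True
  have "(\<integral>u. \<Phi> u (v, w) \<partial>lborel) =
      (\<integral>u. (indicator {0..min v w} u * (1 / (1 - u)\<^sup>2)) * ((1 - v) * (1 - w) * p v * q w) \<partial>lborel)"
    using True by (intro Bochner_Integration.integral_cong) (auto simp: Phi_product indicator_def power_divide)
  also have "\<dots> = (\<integral>u. indicator {0..min v w} u * (1 / (1 - u)\<^sup>2) \<partial>lborel) * ((1 - v) * (1 - w) * p v * q w)"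
    by (rule integral_mult_left_zero)
  also have "\<dots> = p v * q w * bridge_kernel v w"
  \<comment> \<open>At \<open>min v w = 1\<close> the integral over \<open>u\<close> diverges, but
    the factor \<open>(1 - v) * (1 - w)\<close> and the kernel are both 0. Pulling out the constant
    above is valid there too, as a divergent integral has value 0.\<close>
  proof (cases "min v w = 1")
    case True
    with \<open>0 \<le> v \<and> v \<le> 1 \<and> 0 \<le> w \<and> w \<le> 1\<close> have "v = 1" "w = 1" by auto
    then show ?thesis by (simp add: bridge_kernel_def)
  next
    case False
    with True have m: "0 \<le> min v w" "min v w < 1" by auto
    have "min v w / (1 - min v w) * ((1 - v) * (1 - w)) = bridge_kernel v w"
      using m True by (auto simp: bridge_kernel_def min_def field_simps)
    then show ?thesis unfolding integral_inverse_square[OF m]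
      by (metis (no_types, lifting) mult.assoc mult.commute)
  qed
  finally show ?thesis using True by simp
next
  case False
  then have "\<Phi> u (v, w) = 0" for u by (auto simp: Phi_product indicator_def)
  with False show ?thesis by (auto simp: indicator_def)
qed

text \<open>\<open>S\<close> is what remains of \<Phi> after integrating over \<open>(v, w)\<close>,
  and \<open>G\<close> what remains after integrating over \<open>u\<close>. Fubini makes both
  integrable with the same total.\<close>

lemma Fubini_bridge_kernel:
  assumes int: "integrable lborel (\<lambda>(u, x). \<Phi> u x)"
  defines "S \<equiv> \<lambda>u. indicator {0..1} u * ((1 / (1 - u))\<^sup>2 *
      ((\<integral>v. indicator {u..1} v * ((1 - v) * p v) \<partial>lborel) *
       (\<integral>w. indicator {u..1} w * ((1 - w) * q w) \<partial>lborel)))"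
  defines "G \<equiv> \<lambda>v w. indicator {0..1} w * indicator {0..1} v * (p v * q w * bridge_kernel v w)"
  shows "S \<in> borel_measurable borel"
    and "integrable lborel S"
    and "integrable (lborel \<Otimes>\<^sub>M lborel) (\<lambda>(v, w). G v w)"
    and "integral\<^sup>L lborel S = integral\<^sup>L (lborel \<Otimes>\<^sub>M lborel) (\<lambda>(v, w). G v w)"
proof -
  show S[measurable]: "S \<in> borel_measurable borel"
    unfolding S_def indicator_Icc_left by measurable
  have int': "integrable (lborel \<Otimes>\<^sub>M lborel) (\<lambda>(u, x). \<Phi> u x)"
    using int unfolding lborel_prod .
  \<comment> \<open>For almost every \<open>u\<close> the slice is integrable, so its planar
    integral may be iterated and then splits into the two tail integrals.\<close>
  have ae: "AE u in lborel. S u = (\<integral>x. \<Phi> u x \<partial>lborel)"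
    using lborel_pair.AE_integrable_fst[OF int']
  proof eventually_elim
    case (elim u)
    then have "(\<integral>x. \<Phi> u x \<partial>lborel) = (\<integral>v. \<integral>w. \<Phi> u (v, w) \<partial>lborel \<partial>lborel)"
      unfolding lborel_prod[symmetric] by (rule lborel_pair.integral_fst'[symmetric])
    also have "\<dots> = (\<integral>v. indicator {0..1} u * (1 / (1 - u))\<^sup>2 *
        (indicator {u..1} v * ((1 - v) * p v)) * (\<integral>w. indicator {u..1} w * ((1 - w) * q w) \<partial>lborel) \<partial>lborel)"
      unfolding Phi_product integral_mult_right_zero ..
    also have "\<dots> = S u"
      unfolding S_def integral_mult_left_zero integral_mult_right_zero by (simp only: mult.assoc)
    finally show ?case ..
  qed
  have meas: "(\<lambda>u. \<integral>x. \<Phi> u x \<partial>lborel) \<in> borel_measurable lborel"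
    using lborel_pair.integrable_fst[OF int'] by (rule borel_measurable_integrable)
  show "integrable lborel S"
    using lborel_pair.integrable_fst[OF int'] integrable_cong_AE[OF _ meas ae] by simp
  have G: "(\<lambda>x. \<integral>u. \<Phi> u x \<partial>lborel) = (\<lambda>(v, w). G v w)"
    by (auto simp: fun_eq_iff Phi_kernel G_def)
  show "integrable (lborel \<Otimes>\<^sub>M lborel) (\<lambda>(v, w). G v w)"
    using lborel_pair.integrable_snd[OF int'] unfolding G lborel_prod .
  have "integral\<^sup>L lborel S = (\<integral>u. \<integral>x. \<Phi> u x \<partial>lborel \<partial>lborel)"
    using integral_cong_AE[OF _ meas ae] by simp
  also have "\<dots> = (\<integral>x. \<integral>u. \<Phi> u x \<partial>lborel \<partial>lborel)"
    using lborel_pair.integral_fst[OF int'] lborel_pair.integral_snd[OF int'] by simp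
  finally show "integral\<^sup>L lborel S = integral\<^sup>L (lborel \<Otimes>\<^sub>M lborel) (\<lambda>(v, w). G v w)"
    unfolding G lborel_prod .
qed

end

section \<open>Representatives and the trimming weights\<close>

lemma borel_representative:
  assumes "f \<in> borel_measurable (lebesgue_on {0..1::real})"
  obtains f' :: "real \<Rightarrow> real" where "f' \<in> borel_measurable borel"
    "AE x in lborel. indicator {0..1} x * f x = f' x"
proof -
  have "(\<lambda>x. indicator {0..1} x *\<^sub>R f x) \<in> borel_measurable lebesgue"
    using assms by (subst (asm) borel_measurable_restrict_space_iff) auto
  from completion_ex_borel_measurable_real[OF this] show ?thesis
    using that by auto
qed

text \<open>Multiplying by \<open>1 - a - b\<close> cancels the weight inside the interval, so the
  representative of \<open>J x * H' x\<close> also yields one for \<open>H'\<close> restricted to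
  the trimming interval.\<close>

lemma trimming_representative:
  fixes a b :: real and H' J f :: "real \<Rightarrow> real"
  assumes ab: "0 \<le> a" "a < 1 - b" "1 - b \<le> 1"
    and J: "\<And>s. s \<in> {0..1} \<Longrightarrow> J s = trimming_weight a b s"
    and f: "AE x in lborel. indicator {0..1} x * (J x * H' x) = f x"
  shows "AE x in lborel. indicator {a..1 - b} x * H' x = (1 - a - b) * f x"
  \<comment> \<open>The weight vanishes at \<open>a\<close> and \<open>1 - b\<close>, whereas the
    closed interval contains both points.\<close>
  using f AE_lborel_singleton[of a] AE_lborel_singleton[of "1 - b"]
proof eventually_elim
  case (elim x)
  then show ?case
    using ab J[of x] by (cases "x \<in> {0..1}") (auto simp: trimming_weight_def indicator_def field_simps)
qed

text \<open>\<open>Ei\<close> and \<open>Ej\<close> stand for the derivatives of index i and j,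
  \<open>B\<close> and \<open>A\<close> for their trimming intervals. \<open>G\<close> carries index
  i in its first variable, while here index i sits in the outer variable \<open>w\<close>; hence the
  comparison is with \<open>G w v\<close>.\<close>

lemma iterated_integral_swapped_kernel:
  fixes Ei Ej :: "real \<Rightarrow> real" and p q :: "real \<Rightarrow> real" and A B :: "real set"
  defines "G \<equiv> \<lambda>v w. indicator {0..1} w * indicator {0..1} v * (p v * q w * bridge_kernel v w)"
  assumes G: "integrable (lborel \<Otimes>\<^sub>M lborel) (\<lambda>(v, w). G v w)"
    and AB: "A \<in> sets borel" "B \<in> sets borel" "A \<subseteq> {0..1}" "B \<subseteq> {0..1}"
    and c: "c \<noteq> 0" "d \<noteq> 0"
    and p: "AE x in lborel. indicator B x * Ei x = c * p x"
    and q: "AE x in lborel. indicator A x * Ej x = d * q x"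
  shows "iterated_integrable A B (\<lambda>v w. bridge_kernel v w * Ej v * Ei w)"
    and "(LINT w:B|lebesgue. LINT v:A|lebesgue. bridge_kernel v w * Ej v * Ei w) =
      c * d * integral\<^sup>L (lborel \<Otimes>\<^sub>M lborel) (\<lambda>(v, w). G v w)"
proof -
  have swap: "(\<lambda>(v, w). c * d * G w v) = (\<lambda>x. c * d * (case x of (v, w) \<Rightarrow> G w v))"
    by auto
  have int: "integrable (lborel \<Otimes>\<^sub>M lborel) (\<lambda>(v, w). c * d * G w v)"
    unfolding swap using lborel_pair.integrable_product_swap[OF G] by (simp add: case_prod_unfold)
  \<comment> \<open>\<open>G\<close> carries indicators of the unit interval. They cost nothing,
    since \<open>c * p x\<close> is already 0 off \<open>B\<close>, a subset of that
    interval.\<close>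
  have supp: "indicator {0..1} x * (c * p x) = c * p x" if "indicator B x * Ei x = c * p x" for x
    using that AB by (cases "x \<in> B") (auto simp: subset_iff)
  have supq: "indicator {0..1} x * (d * q x) = d * q x" if "indicator A x * Ej x = d * q x" for x
    using that AB by (cases "x \<in> A") (auto simp: subset_iff)
  have ae: "AE w in lborel. AE v in lborel.
      indicator B w * indicator A v * (bridge_kernel v w * Ej v * Ei w) = c * d * G w v"
    using p
  proof eventually_elim
    case (elim w)
    note pw = elim
    show ?case using q
    proof eventually_elim
      case (elim v)
      have "indicator B w * indicator A v * (bridge_kernel v w * Ej v * Ei w) =
          (indicator B w * Ei w) * (indicator A v * Ej v) * bridge_kernel w v"
        by (simp add: bridge_kernel_commute)
      also have "\<dots> = (indicator {0..1} w * (c * p w)) * (indicator {0..1} v * (d * q v)) * bridge_kernel w v"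
        unfolding supp[OF pw] supq[OF elim] by (simp add: pw elim)
      also have "\<dots> = c * d * G w v" by (simp add: G_def)
      finally show ?case .
    qed
  qed
  show "iterated_integrable A B (\<lambda>v w. bridge_kernel v w * Ej v * Ei w)"
    using iterated_integral_AE(1)[OF int AB(1,2) ae] .
  have "(LINT w:B|lebesgue. LINT v:A|lebesgue. bridge_kernel v w * Ej v * Ei w) =
      integral\<^sup>L (lborel \<Otimes>\<^sub>M lborel) (\<lambda>(v, w). c * d * G w v)"
    using iterated_integral_AE(2)[OF int AB(1,2) ae] .
  also have "\<dots> = c * d * integral\<^sup>L (lborel \<Otimes>\<^sub>M lborel) (\<lambda>(v, w). G w v)"
    unfolding swap by (rule integral_mult_right_zero)
  \<comment> \<open>Exchanging the coordinates preserves the product measure.\<close>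
  also have "integral\<^sup>L (lborel \<Otimes>\<^sub>M lborel) (\<lambda>(v, w). G w v) =
      integral\<^sup>L (lborel \<Otimes>\<^sub>M lborel) (\<lambda>(v, w). G v w)"
    using lborel_pair.integral_product_swap[OF borel_measurable_integrable[OF G]]
    by (simp add: case_prod_unfold)
  finally show "(LINT w:B|lebesgue. LINT v:A|lebesgue. bridge_kernel v w * Ej v * Ei w) =
      c * d * integral\<^sup>L (lborel \<Otimes>\<^sub>M lborel) (\<lambda>(v, w). G v w)" .
qed

section \<open>The equality of the three expressions and the trimmed case\<close>

theorem theorem2:
  fixes M :: "real measure" and F :: "real \<Rightarrow> real"
    and k i j :: nat
    and h J H H' g :: "nat \<Rightarrow> real \<Rightarrow> real"
  assumes "real_distribution M" and "F = cdf M"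
    and "i \<in> {1..k}" and "j \<in> {1..k}"
    and "\<forall>r\<in>{i, j}. \<forall>s\<in>{0..1}. J r s \<ge> 0"
    and "\<forall>r\<in>{i, j}. H r = h r \<circ> quantile F"
    and "\<forall>r\<in>{i, j}. stieltjes_derivative (H r) (H' r)"
    and "\<forall>r\<in>{i, j}. g r = (\<lambda>v. J r v * H' r v)"
    and "\<forall>r\<in>{i, j}. g r \<in> borel_measurable (lebesgue_on {0..1})"
    and "\<forall>r\<in>{i, j}. \<forall>u\<in>{0<..<1}. (\<lambda>v. (1 - v) * g r v) absolutely_integrable_on {u..1}"
    and "(\<lambda>(u, v, w). 1 / (1 - u)^2 * (1 - v) * (1 - w) * g i v * g j w)
           absolutely_integrable_on Omega"
  shows
    "(\<lambda>u. alpha (g i) u * alpha (g j) u) absolutely_integrable_on {0..1} \<and>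
     (\<lambda>u. (1 / (1 - u))^2 *
          ((LINT v:{u..1}|lebesgue. (1 - v) * g i v) * (LINT w:{u..1}|lebesgue. (1 - w) * g j w)))
       absolutely_integrable_on {0..1} \<and>
     iterated_integrable {0..1} {0..1} (\<lambda>v w. g i v * g j w * bridge_kernel v w) \<and>
     (LINT u:{0..1}|lebesgue. alpha (g i) u * alpha (g j) u) =
       (LINT u:{0..1}|lebesgue. (1 / (1 - u))^2 *
          ((LINT v:{u..1}|lebesgue. (1 - v) * g i v) * (LINT w:{u..1}|lebesgue. (1 - w) * g j w))) \<and>
     (LINT u:{0..1}|lebesgue. (1 / (1 - u))^2 *
          ((LINT v:{u..1}|lebesgue. (1 - v) * g i v) * (LINT w:{u..1}|lebesgue. (1 - w) * g j w))) =
       (LINT w:{0..1}|lebesgue. LINT v:{0..1}|lebesgue. g i v * g j w * bridge_kernel v w) \<and>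
     (\<forall>a b :: nat \<Rightarrow> real.
        (\<forall>r\<in>{i, j}. 0 \<le> a r \<and> a r < 1 - b r \<and> 1 - b r \<le> 1 \<and>
           (\<forall>s\<in>{0..1}. J r s = trimming_weight (a r) (b r) s)) \<longrightarrow>
        iterated_integrable {a j..1 - b j} {a i..1 - b i} (\<lambda>v w. bridge_kernel v w * H' j v * H' i w) \<and>
        (LINT w:{0..1}|lebesgue. LINT v:{0..1}|lebesgue. g i v * g j w * bridge_kernel v w) =
          1 / ((1 - a i - b i) * (1 - a j - b j)) *
          (LINT w:{a i..1 - b i}|lebesgue. LINT v:{a j..1 - b j}|lebesgue.
             bridge_kernel v w * H' j v * H' i w))"
proof -
  note gmeas = assms(9) and gint = assms(11)
  obtain p where p[measurable]: "p \<in> borel_measurable borel"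
      and gp: "AE x in lborel. indicator {0..1} x * g i x = p x"
    using borel_representative[of "g i"] gmeas by auto
  obtain q where q[measurable]: "q \<in> borel_measurable borel"
      and gq: "AE x in lborel. indicator {0..1} x * g j x = q x"
    using borel_representative[of "g j"] gmeas by auto
  define \<Phi> :: "real \<Rightarrow> real \<times> real \<Rightarrow> real" where
    "\<Phi> = (\<lambda>u (v, w). indicator Omega (u, v, w) * (1 / (1 - u)\<^sup>2 * (1 - v) * (1 - w) * p v * q w))"
  define S where "S = (\<lambda>u. indicator {0..1} u * ((1 / (1 - u))\<^sup>2 *
      ((\<integral>v. indicator {u..1} v * ((1 - v) * p v) \<partial>lborel) *
       (\<integral>w. indicator {u..1} w * ((1 - w) * q w) \<partial>lborel))))"
  define G where "G = (\<lambda>v w. indicator {0..1} w * indicator {0..1} v * (p v * q w * bridge_kernel v w))"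

  \<comment> \<open>Membership in \<open>Omega\<close> is spelled out by comparisons to obtain
    measurability; the remaining bounds \<open>u \<le> 1\<close>, \<open>0 \<le> v\<close> and
    \<open>0 \<le> w\<close> follow from these.\<close>
  have "(\<lambda>(u, v, w). if 0 \<le> u \<and> u \<le> v \<and> u \<le> w \<and> v \<le> 1 \<and> w \<le> 1
      then 1 / (1 - u)\<^sup>2 * (1 - v) * (1 - w) * p v * q w else 0)
      \<in> borel_measurable (borel \<Otimes>\<^sub>M (borel \<Otimes>\<^sub>M borel))"
    by measurable
  moreover have "(\<lambda>(u, x). \<Phi> u x) = (\<lambda>(u, v, w). if 0 \<le> u \<and> u \<le> v \<and> u \<le> w \<and> v \<le> 1 \<and> w \<le> 1
      then 1 / (1 - u)\<^sup>2 * (1 - v) * (1 - w) * p v * q w else 0)"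
    by (auto simp: fun_eq_iff \<Phi>_def Omega_def indicator_def)
  ultimately have "(\<lambda>(u, x). \<Phi> u x) \<in> borel_measurable borel"
    by (simp add: borel_prod)
  moreover have "AE z in lborel. indicator Omega z *\<^sub>R
      (case z of (u, v, w) \<Rightarrow> 1 / (1 - u)^2 * (1 - v) * (1 - w) * g i v * g j w) =
      (case z of (u, x) \<Rightarrow> \<Phi> u x)"
    \<comment> \<open>In the triple \<open>(u, v, w)\<close>, \<open>v\<close> is the first and
      \<open>w\<close> the second component of the second coordinate; exceptional sets in either
      variable stay null in the triple product.\<close>
    using AE_lborel_snd[OF AE_lborel_fst[OF gp]] AE_lborel_snd[OF AE_lborel_snd[OF gq]]
    by eventually_elim (auto simp: \<Phi>_def Omega_def indicator_def split: if_splits)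
  ultimately have int: "integrable lborel (\<lambda>(u, x). \<Phi> u x)"
    using set_integral_lebesgue_AE(1) gint by blast
  note Fub = Fubini_bridge_kernel[OF p q int[unfolded \<Phi>_def], folded S_def G_def]

  \<comment> \<open>Valid for every \<open>u \<ge> 0\<close>, not just almost every one: a null set
    does not affect the tail integral, and \<open>{u..1}\<close> stays inside the unit
    interval.\<close>
  have tail: "(LINT v:{u..1}|lebesgue. (1 - v) * f v) = (\<integral>v. indicator {u..1} v * ((1 - v) * f' v) \<partial>lborel)"
    if [measurable]: "f' \<in> borel_measurable borel"
      and ae: "AE x in lborel. indicator {0..1} x * f x = f' x" and u: "0 \<le> u"
    for f f' :: "real \<Rightarrow> real" and u :: real
  proof (rule set_integral_lebesgue_AE(2))
    show "AE x in lborel. indicator {u..1} x *\<^sub>R ((1 - x) * f x) = indicator {u..1} x * ((1 - x) * f' x)"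
      using ae by eventually_elim (use u in \<open>auto simp: indicator_def split: if_splits\<close>)
  qed measurable
  have S: "indicator {0..1} u *\<^sub>R ((1 / (1 - u))\<^sup>2 *
      ((LINT v:{u..1}|lebesgue. (1 - v) * g i v) * (LINT w:{u..1}|lebesgue. (1 - w) * g j w))) = S u" for u
    unfolding S_def by (cases "u \<in> {0..1}") (auto simp: tail[OF p gp] tail[OF q gq])
  \<comment> \<open>The first two integrands agree at every \<open>u\<close>, including
    \<open>u = 1\<close>, where \<open>1 / (1 - u)\<close> is 0 by convention.\<close>
  have alpha: "alpha (g i) u * alpha (g j) u = (1 / (1 - u))\<^sup>2 *
      ((LINT v:{u..1}|lebesgue. (1 - v) * g i v) * (LINT w:{u..1}|lebesgue. (1 - w) * g j w))" for u
    by (simp add: alpha_def power2_eq_square)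
  note SI = set_integral_lebesgue_AE[OF Fub(1) AE_I2[OF S]]

  have ae: "AE w in lborel. AE v in lborel.
      indicator {0..1} w * indicator {0..1} v * (g i v * g j w * bridge_kernel v w) = G v w"
    using gq
  proof eventually_elim
    case (elim w)
    note qw = elim
    show ?case using gp
    proof eventually_elim
      case (elim v)
      then show ?case using qw by (auto simp: G_def indicator_def split: if_splits)
    qed
  qed
  note GI = iterated_integral_AE[OF Fub(3) _ _ ae]

  have trimmed: "iterated_integrable {a j..1 - b j} {a i..1 - b i} (\<lambda>v w. bridge_kernel v w * H' j v * H' i w) \<and>
      (LINT w:{0..1}|lebesgue. LINT v:{0..1}|lebesgue. g i v * g j w * bridge_kernel v w) =
        1 / ((1 - a i - b i) * (1 - a j - b j)) *
        (LINT w:{a i..1 - b i}|lebesgue. LINT v:{a j..1 - b j}|lebesgue.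
           bridge_kernel v w * H' j v * H' i w)"
    if ab: "\<forall>r\<in>{i, j}. 0 \<le> a r \<and> a r < 1 - b r \<and> 1 - b r \<le> 1 \<and>
           (\<forall>s\<in>{0..1}. J r s = trimming_weight (a r) (b r) s)" for a b :: "nat \<Rightarrow> real"
  proof -
    have pi: "AE x in lborel. indicator {a i..1 - b i} x * H' i x = (1 - a i - b i) * p x"
      by (rule trimming_representative[of _ _ "J i"]) (use ab gp assms(8) in auto)
    have qj: "AE x in lborel. indicator {a j..1 - b j} x * H' j x = (1 - a j - b j) * q x"
      by (rule trimming_representative[of _ _ "J j"]) (use ab gq assms(8) in auto)
    have c: "1 - a i - b i \<noteq> 0" "1 - a j - b j \<noteq> 0"
      using ab by auto
    have sub: "{a j..1 - b j} \<subseteq> {0..1}" "{a i..1 - b i} \<subseteq> {0..1}"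
      using ab by auto
    note TS = iterated_integral_swapped_kernel[OF Fub(3)[unfolded G_def] _ _ sub c pi qj, folded G_def]
    \<comment> \<open>\<open>TS\<close> produces the factor
      \<open>(1 - a i - b i) * (1 - a j - b j)\<close>, which cancels against its reciprocal in the
      claim.\<close>
    show ?thesis
      using TS GI(2) c by simp
  qed
  show ?thesis
    unfolding alpha using SI GI Fub(2,4) trimmed by simp
qed

end
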